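(* Let $k$ be a positive integer and suppose that $q$ and $p=\frac{q^k-1}{q-1}$ are odd primes with $k<q$. Then $\frac{q}{k}\in\mathcal{I}_{pq}$.
   Context: All groups are finite. For a transitive group $G\leq\operatorname{Sym}(\Omega)$, a subset $\mathcal{F}\subseteq G$ is intersecting if for all $g,h\in\mathcal{F}$ there exists $\omega\in\Omega$ with $\omega^g=\omega^h$. The intersection density of $G$ is $\rho(G)=\max\{|\mathcal{F}|/|G_\omega| : \mathcal{F}\subseteq G \text{ intersecting}\}$, where $G_\omega$ is the stabilizer of a point $\omega\in\Omega$. For $n\geq 2$, $\mathcal{I}_n:=\{\rho(G) : G \text{ is a transitive permutation group of degree } n\}$, where the degree is $|\Omega|$. *)

theory Defs
  imports Complex_Main "HOL-Algebra.Group_Action" "HOL-Computational_Algebra.Primes"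
begin

text \<open>A permutation group on \<open>\<Omega>\<close> is given by its set of elements, a subgroup of
  \<^const>\<open>BijGroup\<close> \<open>\<Omega>\<close>. Its natural action on \<open>\<Omega>\<close> is the inclusion, hence \<^const>\<open>id\<close> below.\<close>

abbreviation perm_group :: "'a set \<Rightarrow> ('a \<Rightarrow> 'a) set \<Rightarrow> ('a \<Rightarrow> 'a) monoid" where
  "perm_group \<Omega> G \<equiv> (BijGroup \<Omega>)\<lparr>carrier := G\<rparr>"

definition transitive_perm_group :: "'a set \<Rightarrow> ('a \<Rightarrow> 'a) set \<Rightarrow> bool" where
  "transitive_perm_group \<Omega> G \<longleftrightarrow>
     subgroup G (BijGroup \<Omega>) \<and> transitive_action (perm_group \<Omega> G) \<Omega> id"

definition intersecting :: "'a set \<Rightarrow> ('a \<Rightarrow> 'a) set \<Rightarrow> bool" where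
  "intersecting \<Omega> F \<longleftrightarrow> (\<forall>g\<in>F. \<forall>h\<in>F. \<exists>\<omega>\<in>\<Omega>. g \<omega> = h \<omega>)"

text \<open>The point \<open>\<omega>\<close> ranges over all of \<open>\<Omega>\<close>, which avoids choosing one. For transitive groups on
  finite sets the point is irrelevant, see \<open>intersection_density_eq\<close> below.\<close>

definition intersection_density :: "'a set \<Rightarrow> ('a \<Rightarrow> 'a) set \<Rightarrow> real" where
  "intersection_density \<Omega> G =
     Max {real (card F) / real (card (stabilizer (perm_group \<Omega> G) id \<omega>)) | F \<omega>.
            F \<subseteq> G \<and> intersecting \<Omega> F \<and> \<omega> \<in> \<Omega>}"

text \<open>The densities of the transitive groups of degree \<open>n\<close>, for \<open>n \<ge> 2\<close>. The density is invariant
  under relabelling of the points, so it suffices to let \<open>\<Omega>\<close> range over sets of natural numbers.\<close>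

definition intersection_densities :: "nat \<Rightarrow> real set" where
  "intersection_densities n =
     {intersection_density \<Omega> G | (\<Omega> :: nat set) G.
        finite \<Omega> \<and> card \<Omega> = n \<and> transitive_perm_group \<Omega> G}"

lemma transitive_perm_group_iff:
  "transitive_perm_group \<Omega> G \<longleftrightarrow>
     subgroup G (BijGroup \<Omega>) \<and> (\<forall>x\<in>\<Omega>. \<forall>y\<in>\<Omega>. \<exists>g\<in>G. g x = y)"
proof -
  have "transitive_action (perm_group \<Omega> G) \<Omega> id \<longleftrightarrow> (\<forall>x\<in>\<Omega>. \<forall>y\<in>\<Omega>. \<exists>g\<in>G. g x = y)"
    if G: "subgroup G (BijGroup \<Omega>)"
  proof -
    have "group (perm_group \<Omega> G)"
      using G group_BijGroup by (rule subgroup.subgroup_is_group)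
    moreover have "id \<in> hom (perm_group \<Omega> G) (BijGroup \<Omega>)"
      using subgroup.subset[OF G] by (auto simp: hom_def)
    ultimately have "group_action (perm_group \<Omega> G) \<Omega> id"
      using group_BijGroup
      by (simp add: group_action_def group_hom_def group_hom_axioms_def)
    then show ?thesis
      by (auto simp: transitive_action_def transitive_action_axioms_def)
  qed
  then show ?thesis
    by (auto simp: transitive_perm_group_def)
qed

lemma card_stabilizer_eq:
  assumes "transitive_perm_group \<Omega> G" "finite \<Omega>" "\<omega> \<in> \<Omega>" "\<omega>' \<in> \<Omega>"
  shows "card (stabilizer (perm_group \<Omega> G) id \<omega>) = card (stabilizer (perm_group \<Omega> G) id \<omega>')"
proof -
  interpret transitive_action "perm_group \<Omega> G" \<Omega> id
    using assms(1) by (simp add: transitive_perm_group_def)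
  have orb: "orbit (perm_group \<Omega> G) id x = \<Omega>" if "x \<in> \<Omega>" for x
    using unique_orbit[OF that] element_image[OF _ that] by (fastforce simp: orbit_def)
  have "card \<Omega> * card (stabilizer (perm_group \<Omega> G) id x) = order (perm_group \<Omega> G)"
    if "x \<in> \<Omega>" for x
    using orbit_stabilizer_theorem[OF that] orb[OF that] by simp
  from this[OF assms(3)] this[OF assms(4)] have
    "card \<Omega> * card (stabilizer (perm_group \<Omega> G) id \<omega>) =
     card \<Omega> * card (stabilizer (perm_group \<Omega> G) id \<omega>')"
    by simp
  then show ?thesis
    using assms(2,3) by auto
qed

lemma intersection_density_eq:
  assumes "transitive_perm_group \<Omega> G" "finite \<Omega>" "\<omega> \<in> \<Omega>"
  shows "intersection_density \<Omega> G =
    Max {real (card F) / real (card (stabilizer (perm_group \<Omega> G) id \<omega>)) | F.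
           F \<subseteq> G \<and> intersecting \<Omega> F}"
proof -
  have "{real (card F) / real (card (stabilizer (perm_group \<Omega> G) id \<omega>)) | F \<omega>.
            F \<subseteq> G \<and> intersecting \<Omega> F \<and> \<omega> \<in> \<Omega>} =
        {real (card F) / real (card (stabilizer (perm_group \<Omega> G) id \<omega>)) | F.
           F \<subseteq> G \<and> intersecting \<Omega> F}" (is "?A = ?B")
  proof
    show "?A \<subseteq> ?B"
      using card_stabilizer_eq[OF assms(1,2) _ assms(3)] by auto
    show "?B \<subseteq> ?A"
      using assms(3) by blast
  qed
  then show ?thesis
    by (simp add: intersection_density_def)
qed

end

theory Submission
  imports Defs "HOL-Computational_Algebra.Polynomial" "HOL-Number_Theory.Cong"
begin

text \<open>
  Write \<open>K\<close> for the field with \<open>q\<close> elements. Let \<open>C\<close> be a set of words \<open>w\<close>, functions from the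
  integers modulo \<open>p\<close> to \<open>K\<close>, that is a vector space over \<open>K\<close>, is invariant under the shift
  \<open>n \<mapsto> n + 1\<close> and the multiplier \<open>n \<mapsto> q n\<close>, and does not vanish identically at any position.
  The maps \<open>(n, c) \<mapsto> (m, c + w(m))\<close>, where \<open>m = q^i n + s\<close> and \<open>w\<close> is in \<open>C\<close>, form a transitive group on the \<open>p q\<close> pairs \<open>(n, c)\<close>. Since \<open>q\<close> has order \<open>k\<close>
  modulo \<open>p\<close>, and a word of \<open>C\<close> takes each value at a given position equally often, a point
  stabilizer has \<open>k |C| / q\<close> elements.

  If every word of \<open>C\<close> has a zero, then the maps with \<open>i = s = 0\<close> form an intersecting set of
  size \<open>|C|\<close>, which gives the ratio \<open>q / k\<close>. No intersecting set is larger
  (\<open>card_intersecting_le\<close>). Two maps with the same \<open>i\<close> that agree at a point have the same \<open>s\<close>, so an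
  intersecting set with a single value of \<open>i\<close> has at most \<open>|C|\<close> elements. Two maps with different
  values of \<open>i\<close> send only one \<open>n\<close> to the same \<open>m\<close>, as \<open>q^i - q^j\<close> is invertible modulo \<open>p\<close>, so their
  words agree at this \<open>m\<close>. If several values of \<open>i\<close> occur, then the words of all maps with a given \<open>i\<close>
  have a prescribed value at some position. There are at most \<open>|C| / q\<close> of them, hence at most
  \<open>k |C| / q \<le> |C|\<close> maps in all.

  The code \<open>C\<close> is a minimal ideal of \<open>K[x] / (x\<^sup>p - 1)\<close> inside the ideal of polynomials with
  coefficient sum zero. Ideals are invariant under the multiplier because \<open>f(x)\<^sup>q = f(x\<^sup>q)\<close>.
  The annihilator of \<open>C\<close> is a prime ideal, modulo which every element is a root of \<open>X^(q^k) - X\<close>,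
  as \<open>q^k\<close> is \<open>1\<close> modulo \<open>p\<close>; hence \<open>|C| \<le> q^k\<close> (\<open>card_generated_code_le\<close>). On the other hand
  the scalar multiples of the shifts of a nonzero word of \<open>C\<close> are \<open>p (q - 1) = q^k - 1\<close> different
  nonzero words, since \<open>p\<close> is prime to \<open>q - 1\<close> (\<open>scalar_shift_eq\<close>). So \<open>|C| = q^k\<close> and these are all the
  nonzero words. As \<open>k > 1\<close>, some nonzero word has a zero, and therefore each one does
  (\<open>generated_code_zero\<close>).
\<close>

section \<open>Relabelling the points of a permutation group\<close>

lemma stabilizer_perm_group: "stabilizer (perm_group \<Omega> G) id \<omega> = {g \<in> G. g \<omega> = \<omega>}"
  by (simp add: stabilizer_def)

text \<open>Conjugation by a bijection onto an initial segment of the natural numbers preserves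
  the density, so the points may be taken from any type.\<close>

lemma intersection_density_in_intersection_densities:
  fixes \<Omega> :: "'a set"
  assumes G: "transitive_perm_group \<Omega> G" and fin: "finite \<Omega>"
  shows "intersection_density \<Omega> G \<in> intersection_densities (card \<Omega>)"
proof -
  define \<Omega>' where "\<Omega>' = {0..<card \<Omega>}"
  obtain f where f: "bij_betw f \<Omega> \<Omega>'"
    using ex_bij_betw_finite_nat[OF fin] by (auto simp: \<Omega>'_def)
  define h where "h = inv_into \<Omega> f"
  have h: "bij_betw h \<Omega>' \<Omega>"
    using f by (simp add: h_def bij_betw_inv_into)
  have f_in: "f x \<in> \<Omega>'" if "x \<in> \<Omega>" for x using f that by (auto simp: bij_betw_def)
  have h_in: "h x \<in> \<Omega>" if "x \<in> \<Omega>'" for x using h that by (auto simp: bij_betw_def)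
  have hf: "h (f x) = x" if "x \<in> \<Omega>" for x
    using f that by (simp add: h_def bij_betw_inv_into_left)
  have fh: "f (h x) = x" if "x \<in> \<Omega>'" for x
    using f that by (simp add: h_def bij_betw_inv_into_right)
  define c where "c g = (\<lambda>x\<in>\<Omega>'. f (g (h x)))" for g
  have sub: "subgroup G (BijGroup \<Omega>)" and trans: "\<And>x y. x \<in> \<Omega> \<Longrightarrow> y \<in> \<Omega> \<Longrightarrow> \<exists>g\<in>G. g x = y"
    using G by (auto simp: transitive_perm_group_iff)
  have G_Bij: "G \<subseteq> Bij \<Omega>"
    using subgroup.subset[OF sub] by (simp add: BijGroup_def)
  have g_in: "g x \<in> \<Omega>" if "g \<in> Bij \<Omega>" "x \<in> \<Omega>" for g x
    using that Bij_imp_funcset by blast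
  have c_Bij: "c g \<in> Bij \<Omega>'" if "g \<in> Bij \<Omega>" for g
  proof -
    have "bij_betw (f \<circ> (g \<circ> h)) \<Omega>' \<Omega>'"
      using f h that by (auto intro!: bij_betw_trans simp: Bij_def)
    moreover have "bij_betw (c g) \<Omega>' \<Omega>' \<longleftrightarrow> bij_betw (f \<circ> (g \<circ> h)) \<Omega>' \<Omega>'"
      by (rule bij_betw_cong) (simp add: c_def)
    ultimately show ?thesis
      by (auto simp: Bij_def c_def)
  qed
  have c_hom: "c \<in> hom (BijGroup \<Omega>) (BijGroup \<Omega>')"
  proof (rule homI)
    fix x y assume "x \<in> carrier (BijGroup \<Omega>)" "y \<in> carrier (BijGroup \<Omega>)"
    then have xy: "x \<in> Bij \<Omega>" "y \<in> Bij \<Omega>" by (auto simp: BijGroup_def)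
    have "c (compose \<Omega> x y) = compose \<Omega>' (c x) (c y)"
      by (rule ext) (auto simp: c_def compose_def h_in f_in hf g_in[OF xy(2)])
    then show "c (x \<otimes>\<^bsub>BijGroup \<Omega>\<^esub> y) = c x \<otimes>\<^bsub>BijGroup \<Omega>'\<^esub> c y"
      using xy c_Bij by (simp add: BijGroup_def)
  qed (use c_Bij in \<open>simp add: BijGroup_def\<close>)
  have c_f: "c g (f x) = f (g x)" if "x \<in> \<Omega>" for g x
    using that by (simp add: c_def f_in hf)
  have eq_iff: "c g (f x) = c g' (f x) \<longleftrightarrow> g x = g' x"
    if "x \<in> \<Omega>" "g \<in> Bij \<Omega>" "g' \<in> Bij \<Omega>" for g g' x
    using c_f[OF that(1)] hf[OF g_in[OF that(2,1)]] hf[OF g_in[OF that(3,1)]] by metis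
  have c_inj: "inj_on c (Bij \<Omega>)"
  proof (rule inj_onI)
    fix x y assume xy: "x \<in> Bij \<Omega>" "y \<in> Bij \<Omega>" "c x = c y"
    show "x = y"
    proof (rule extensionalityI)
      show "x \<in> extensional \<Omega>" "y \<in> extensional \<Omega>" using xy by (auto simp: Bij_def)
      show "x z = y z" if "z \<in> \<Omega>" for z using eq_iff[OF that xy(1,2)] xy(3) by simp
    qed
  qed
  have sub': "subgroup (c ` G) (BijGroup \<Omega>')"
    by (rule group_hom.subgroup_img_is_subgroup[OF _ sub])
      (simp add: c_hom group_BijGroup group_hom_def group_hom_axioms_def)
  have trans': "\<exists>g\<in>c ` G. g x = y" if "x \<in> \<Omega>'" "y \<in> \<Omega>'" for x y
  proof -
    obtain g where "g \<in> G" "g (h x) = h y"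
      using trans[OF h_in[OF \<open>x \<in> \<Omega>'\<close>] h_in[OF \<open>y \<in> \<Omega>'\<close>]] by blast
    then have "c g x = y" using that by (simp add: c_def fh)
    then show ?thesis using \<open>g \<in> G\<close> by blast
  qed
  have inter: "intersecting \<Omega>' (c ` F) \<longleftrightarrow> intersecting \<Omega> F" if "F \<subseteq> G" for F
  proof -
    have \<Omega>': "\<Omega>' = f ` \<Omega>" using f by (simp add: bij_betw_def)
    have "(\<exists>y\<in>\<Omega>'. c g y = c g' y) \<longleftrightarrow> (\<exists>x\<in>\<Omega>. g x = g' x)" if "g \<in> F" "g' \<in> F" for g g'
    proof -
      have "g \<in> Bij \<Omega>" "g' \<in> Bij \<Omega>" using that \<open>F \<subseteq> G\<close> G_Bij by auto
      then show ?thesis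
        unfolding \<Omega>' bex_simps(7) using eq_iff by blast
    qed
    then show ?thesis by (simp add: intersecting_def)
  qed
  have stab: "card (stabilizer (perm_group \<Omega>' (c ` G)) id (f x)) =
      card (stabilizer (perm_group \<Omega> G) id x)" if x: "x \<in> \<Omega>" for x
  proof -
    have "{g \<in> c ` G. g (f x) = f x} = c ` {g \<in> G. g x = x}"
    proof -
      have "c g (f x) = f x \<longleftrightarrow> g x = x" if "g \<in> G" for g
      proof -
        have "g x \<in> \<Omega>" using g_in x that G_Bij by blast
        then show ?thesis using c_f[OF x] hf x by metis
      qed
      then show ?thesis by auto
    qed
    moreover have "inj_on c {g \<in> G. g x = x}"
      using c_inj G_Bij by (auto intro: inj_on_subset)
    ultimately show ?thesis
      by (simp add: stabilizer_perm_group card_image)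
  qed
  have cardF: "card (c ` F) = card F" if "F \<subseteq> G" for F
    using c_inj G_Bij that by (meson card_image inj_on_subset)
  have "{real (card F) / real (card (stabilizer (perm_group \<Omega>' (c ` G)) id \<omega>)) | F \<omega>.
            F \<subseteq> c ` G \<and> intersecting \<Omega>' F \<and> \<omega> \<in> \<Omega>'} =
        {real (card F) / real (card (stabilizer (perm_group \<Omega> G) id \<omega>)) | F \<omega>.
            F \<subseteq> G \<and> intersecting \<Omega> F \<and> \<omega> \<in> \<Omega>}" (is "?A = ?B")
  proof (intro equalityI subsetI)
    fix r assume "r \<in> ?A"
    then obtain F' \<omega> where r: "F' \<subseteq> c ` G" "intersecting \<Omega>' F'" "\<omega> \<in> \<Omega>'"
      "r = real (card F') / real (card (stabilizer (perm_group \<Omega>' (c ` G)) id \<omega>))"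
      by blast
    then obtain F where F: "F \<subseteq> G" "F' = c ` F" by (meson subset_imageE)
    have "r = real (card F) / real (card (stabilizer (perm_group \<Omega> G) id (h \<omega>)))"
      using stab[OF h_in[OF r(3)]] r(3,4) F cardF by (simp add: fh)
    then show "r \<in> ?B" using F r inter h_in by blast
  next
    fix r assume "r \<in> ?B"
    then obtain F \<omega> where r: "F \<subseteq> G" "intersecting \<Omega> F" "\<omega> \<in> \<Omega>"
      "r = real (card F) / real (card (stabilizer (perm_group \<Omega> G) id \<omega>))"
      by blast
    then have "r = real (card (c ` F)) / real (card (stabilizer (perm_group \<Omega>' (c ` G)) id (f \<omega>)))"
      using stab cardF by simp
    moreover have "c ` F \<subseteq> c ` G" "intersecting \<Omega>' (c ` F)" "f \<omega> \<in> \<Omega>'"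
      using r inter f_in by auto
    ultimately show "r \<in> ?A" by blast
  qed
  then have "intersection_density \<Omega> G = intersection_density \<Omega>' (c ` G)"
    by (simp add: intersection_density_def)
  moreover have "transitive_perm_group \<Omega>' (c ` G)"
    using sub' trans' by (simp add: transitive_perm_group_iff)
  ultimately show ?thesis
    by (auto simp: intersection_densities_def \<Omega>'_def intro!: exI[of _ "{0..<card \<Omega>}"])
qed

section \<open>The group of an invariant cyclic code\<close>

text \<open>A linear code of length \<open>p\<close> over the integers modulo \<open>q\<close> that is closed under shifts and under
  the multiplier \<open>q\<close>. A word is a function on all integers that is periodic modulo \<open>p\<close>, and its
  entries are the representatives in \<open>{0..<q}\<close>. The equation for \<open>q ^ k\<close> makes \<open>q\<close> an element of
  order \<open>k\<close> modulo \<open>p\<close>.\<close>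

locale invariant_code =
  fixes p q k :: nat and C :: "(int \<Rightarrow> int) set"
  assumes prime_p: "prime p" and q_gt_1: "q > 1" and k_pos: "k > 0"
    and size_eq: "q ^ k = p * (q - 1) + 1"
    and finite_C: "finite C"
    and range_C: "w \<in> C \<Longrightarrow> w n \<in> {0..<int q}"
    and cong_C: "w \<in> C \<Longrightarrow> [n = m] (mod int p) \<Longrightarrow> w n = w m"
    and add_C: "w \<in> C \<Longrightarrow> v \<in> C \<Longrightarrow> (\<lambda>n. (w n + v n) mod int q) \<in> C"
    and minus_C: "w \<in> C \<Longrightarrow> (\<lambda>n. (- w n) mod int q) \<in> C"
    and shift_C: "w \<in> C \<Longrightarrow> \<exists>v\<in>C. \<forall>n. v (n + s) = w n"
    and multiplier_C: "w \<in> C \<Longrightarrow> \<exists>v\<in>C. \<forall>n. v (int q * n) = w n"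
    and onto_C: "c \<in> {0..<int q} \<Longrightarrow> \<exists>w\<in>C. w n = c"
begin

definition points :: "(int \<times> int) set" where
  "points = {0..<int p} \<times> {0..<int q}"

text \<open>The position is moved by an affine map, then the entry of the word at the new position is added
  to the colour. Outside the points the map is undefined, as \<^const>\<open>BijGroup\<close> requires.\<close>

definition act :: "nat \<Rightarrow> int \<Rightarrow> (int \<Rightarrow> int) \<Rightarrow> int \<times> int \<Rightarrow> int \<times> int" where
  "act i s w = (\<lambda>(n, c)\<in>points. ((int q ^ i * n + s) mod int p, (c + w (int q ^ i * n + s)) mod int q))"

text \<open>The exponent ranges over all natural numbers although it matters only modulo \<open>k\<close>, which
  makes closure under composition immediate; \<open>act_normal_form\<close> and \<open>act_inject\<close> give unique
  representatives.\<close>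

definition code_group :: "(int \<times> int \<Rightarrow> int \<times> int) set" where
  "code_group = {act i s w | i s w. w \<in> C}"

lemma p_gt_1: "p > 1"
  using prime_p prime_gt_1_nat by auto

lemma act_apply:
  "n \<in> {0..<int p} \<Longrightarrow> c \<in> {0..<int q} \<Longrightarrow>
    act i s w (n, c) = ((int q ^ i * n + s) mod int p, (c + w (int q ^ i * n + s)) mod int q)"
  by (simp add: act_def points_def)

lemma act_in_points: "x \<in> points \<Longrightarrow> act i s w x \<in> points"
  using p_gt_1 q_gt_1 by (auto simp: act_def points_def)

lemma act_eqI:
  assumes "\<And>n c. n \<in> {0..<int p} \<Longrightarrow> c \<in> {0..<int q} \<Longrightarrow> f (n, c) = g (n, c)"
    and "f \<in> extensional points" "g \<in> extensional points"
  shows "f = g"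
  by (rule extensionalityI[where A = points]) (use assms in \<open>auto simp: points_def\<close>)

lemma act_extensional: "act i s w \<in> extensional points"
  by (simp add: act_def)

lemma finite_points: "finite points"
  by (simp add: points_def)

lemma card_points: "card points = p * q"
  by (simp add: points_def)

lemma q_power_k: "[int q ^ (i * k) = 1] (mod int p)"
proof -
  have "[int (q ^ k) = 1] (mod int p)"
    unfolding size_eq by (simp add: cong_iff_dvd_diff)
  then have "[int (q ^ k) ^ i = 1 ^ i] (mod int p)"
    by (rule cong_pow)
  then show ?thesis
    by (simp add: mult.commute flip: power_mult)
qed

lemma q_power_inverse: "[int q ^ i * int q ^ (i * (k - 1)) = 1] (mod int p)"
proof -
  have "i + i * (k - 1) = i * k"
    using k_pos by (metis Suc_pred' mult_Suc_right)
  then show ?thesis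
    using q_power_k[of i] by (simp flip: power_add)
qed

lemma q_power_less_p: "i < k \<Longrightarrow> q ^ i < p"
proof -
  assume "i < k"
  then have "q * q ^ i \<le> q ^ k"
    using q_gt_1 by (simp flip: power_Suc add: power_increasing Suc_le_eq)
  also have "\<dots> < q * p"
  proof -
    have "p * (q - 1) + p = q * p" using q_gt_1 by (cases q) auto
    then show ?thesis using p_gt_1 by (simp add: size_eq)
  qed
  finally show ?thesis by simp
qed

lemma coprime_q_power_diff:
  assumes "i < k" "j < k" "i \<noteq> j"
  shows "coprime (int p) (int q ^ i - int q ^ j)"
proof -
  have "int q ^ i \<noteq> int q ^ j"
    using assms q_gt_1 by simp
  moreover have "int q ^ i < int p" "int q ^ j < int p"
    using q_power_less_p assms by (metis of_nat_less_iff of_nat_power)+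
  moreover have q_pos: "int q ^ l > 0" for l
    using q_gt_1 by simp
  ultimately have "\<not> int p dvd int q ^ i - int q ^ j"
    using dvd_imp_le_int[of "int q ^ i - int q ^ j" "int p"] q_pos[of i] q_pos[of j]
    by linarith
  then show ?thesis
    using prime_p by (intro prime_imp_coprime) auto
qed

lemma affine_C:
  assumes "w \<in> C"
  shows "\<exists>v\<in>C. \<forall>n. v (int q ^ i * n + s) = w n"
  using assms
proof (induction i arbitrary: w)
  case 0
  then show ?case using shift_C by simp
next
  case (Suc i)
  obtain w' where w': "w' \<in> C" "\<And>n. w' (int q * n) = w n"
    using multiplier_C[OF Suc.prems] by blast
  obtain v where v: "v \<in> C" "\<And>n. v (int q ^ i * n + s) = w' n"
    using Suc.IH[OF w'(1)] by blast
  have "v (int q ^ Suc i * n + s) = w n" for n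
    using v(2)[of "int q * n"] w'(2) by (simp add: ac_simps)
  then show ?case using v(1) by blast
qed

lemma zero_C: "(\<lambda>n. 0) \<in> C"
proof -
  obtain w where w: "w \<in> C" using onto_C[of 0 0] q_gt_1 by auto
  have "(\<lambda>n. (w n + (- w n) mod int q) mod int q) = (\<lambda>n. 0)"
    by (simp add: mod_simps)
  then show ?thesis using add_C[OF w minus_C[OF w]] by simp
qed

lemma diff_C:
  assumes "w \<in> C" "v \<in> C"
  shows "(\<lambda>n. (w n - v n) mod int q) \<in> C"
  using add_C[OF assms(1) minus_C[OF assms(2)]] by (simp add: mod_simps)

lemma act_compose:
  assumes "w \<in> C" "v \<in> C"
  shows "compose points (act i s w) (act j t v) \<in> code_group"
proof -
  obtain v' where v': "v' \<in> C" "\<And>n. v' (int q ^ i * n + s) = v n"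
    using affine_C[OF assms(2)] by blast
  define u where "u = (\<lambda>n. (w n + v' n) mod int q)"
  have "compose points (act i s w) (act j t v) = act (i + j) (int q ^ i * t + s) u"
  proof (rule act_eqI)
    fix n c assume nc: "n \<in> {0..<int p}" "c \<in> {0..<int q}"
    define m where "m = int q ^ j * n + t"
    have in_pts: "m mod int p \<in> {0..<int p}" "(c + v m) mod int q \<in> {0..<int q}"
      using p_gt_1 q_gt_1 by auto
    have m_mod: "[int q ^ i * (m mod int p) + s = int q ^ i * m + s] (mod int p)"
      by (intro cong_add cong_mult) auto
    then have "w (int q ^ i * (m mod int p) + s) = w (int q ^ i * m + s)"
      "(int q ^ i * (m mod int p) + s) mod int p = (int q ^ i * m + s) mod int p"
      using cong_C[OF assms(1) m_mod] m_mod by (simp_all add: cong_def)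
    moreover have exponents: "int q ^ (i + j) * n + (int q ^ i * t + s) = int q ^ i * m + s"
      by (simp add: m_def algebra_simps power_add)
    moreover have "act j t v (n, c) = (m mod int p, (c + v m) mod int q)"
      using nc by (simp add: act_apply m_def)
    moreover have "((c + v m) mod int q + w (int q ^ i * m + s)) mod int q =
        (c + u (int q ^ i * m + s)) mod int q"
      using v'(2)[of m] by (simp add: u_def mod_simps ac_simps)
    ultimately have "compose points (act i s w) (act j t v) (n, c) =
        ((int q ^ i * m + s) mod int p, (c + u (int q ^ i * m + s)) mod int q)"
      using nc in_pts by (simp add: compose_def act_apply points_def)
    then show "compose points (act i s w) (act j t v) (n, c) =
        act (i + j) (int q ^ i * t + s) u (n, c)"
      by (simp only: act_apply[OF nc] exponents)
  qed (simp_all add: act_extensional)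
  then show ?thesis
    using add_C[OF assms(1) v'(1)] by (auto simp: code_group_def u_def)
qed

lemma act_zero: "act 0 0 (\<lambda>n. 0) = (\<lambda>x\<in>points. x)"
  by (rule act_eqI, simp add: act_apply points_def, simp_all add: act_extensional)

lemma act_left_inverse:
  assumes "w \<in> C"
  shows "\<exists>h\<in>code_group. compose points h (act i s w) = (\<lambda>x\<in>points. x)"
proof -
  \<comment> \<open>\<open>q ^ j\<close> inverts \<open>q ^ i\<close> modulo \<open>p\<close>.\<close>
  define j where "j = i * (k - 1)"
  obtain v where v: "v \<in> C" "\<And>m. v (int q ^ j * m + (- (int q ^ j * s))) = (- w m) mod int q"
    using affine_C[OF minus_C[OF assms], of j "- (int q ^ j * s)"] by blast
  define h where "h = act j (- (int q ^ j * s)) v"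
  have "compose points h (act i s w) = (\<lambda>x\<in>points. x)"
  proof (rule act_eqI)
    fix n c assume nc: "n \<in> {0..<int p}" "c \<in> {0..<int q}"
    define m where "m = int q ^ i * n + s"
    have in_pts: "m mod int p \<in> {0..<int p}" "(c + w m) mod int q \<in> {0..<int q}"
      using p_gt_1 q_gt_1 by auto
    have cong: "[int q ^ j * (m mod int p) + (- (int q ^ j * s)) = int q ^ j * m + (- (int q ^ j * s))] (mod int p)"
      by (intro cong_add cong_mult) auto
    have "[(int q ^ i * int q ^ j) * n = 1 * n] (mod int p)"
      unfolding j_def by (intro cong_mult q_power_inverse) auto
    moreover have "int q ^ j * m + (- (int q ^ j * s)) = (int q ^ i * int q ^ j) * n"
      by (simp add: m_def algebra_simps)
    ultimately have "(int q ^ j * (m mod int p) + (- (int q ^ j * s))) mod int p = n"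
      using cong nc(1) by (simp add: cong_def)
    moreover have "v (int q ^ j * (m mod int p) + (- (int q ^ j * s))) = (- w m) mod int q"
      using cong_C[OF v(1) cong] v(2) by simp
    moreover have "((c + w m) mod int q + (- w m) mod int q) mod int q = c"
      using nc(2) by (simp add: mod_simps)
    ultimately show "compose points h (act i s w) (n, c) = (\<lambda>x\<in>points. x) (n, c)"
      using nc in_pts by (simp add: compose_def h_def act_apply points_def flip: m_def)
  qed simp_all
  moreover have "h \<in> code_group" using v(1) by (auto simp: h_def code_group_def)
  ultimately show ?thesis by blast
qed

lemma code_group_Bij: "code_group \<subseteq> Bij points"
proof
  fix g assume "g \<in> code_group"
  then obtain i s w where g: "g = act i s w" and w: "w \<in> C" by (auto simp: code_group_def)
  obtain h where h: "compose points h g = (\<lambda>x\<in>points. x)"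
    using act_left_inverse[OF w] g by blast
  have "h (g x) = x" if "x \<in> points" for x
    using fun_cong[OF h, of x] that by (simp add: compose_def)
  then have "inj_on g points" by (metis inj_onI)
  moreover have "g ` points \<subseteq> points" using act_in_points by (auto simp: g)
  ultimately have "bij_betw g points points"
    using finite_points by (simp add: bij_betw_def endo_inj_surj)
  then show "g \<in> Bij points" by (simp add: Bij_def g act_extensional)
qed

lemma transitive_code_group: "transitive_perm_group points code_group"
  unfolding transitive_perm_group_iff
proof (intro conjI ballI)
  interpret B: group "BijGroup points" by (rule group_BijGroup)
  show "subgroup code_group (BijGroup points)"
  proof
    show "code_group \<subseteq> carrier (BijGroup points)"
      using code_group_Bij by (simp add: BijGroup_def)
    show "x \<otimes>\<^bsub>BijGroup points\<^esub> y \<in> code_group" if "x \<in> code_group" "y \<in> code_group" for x y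
    proof -
      have "x \<otimes>\<^bsub>BijGroup points\<^esub> y = compose points x y"
        using that code_group_Bij by (auto simp: BijGroup_def)
      then show ?thesis using that act_compose by (auto simp: code_group_def)
    qed
    show "\<one>\<^bsub>BijGroup points\<^esub> \<in> code_group"
    proof -
      have "(\<lambda>x\<in>points. x) \<in> code_group"
        unfolding code_group_def
        by (intro CollectI exI[of _ "0::nat"] exI[of _ "0::int"] exI[of _ "\<lambda>_. 0"])
          (simp add: act_zero zero_C)
      then show ?thesis by (simp add: BijGroup_def)
    qed
    show "inv\<^bsub>BijGroup points\<^esub> x \<in> code_group" if x: "x \<in> code_group" for x
    proof -
      obtain h where h: "h \<in> code_group" "compose points h x = (\<lambda>x\<in>points. x)"
      proof -
        obtain i s w where "x = act i s w" "w \<in> C"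
          using x by (auto simp: code_group_def)
        then show thesis
          using act_left_inverse[of w i s] that by blast
      qed
      have "h \<otimes>\<^bsub>BijGroup points\<^esub> x = \<one>\<^bsub>BijGroup points\<^esub>"
        using h x code_group_Bij by (auto simp: BijGroup_def)
      then have "inv\<^bsub>BijGroup points\<^esub> x = h"
        using h x code_group_Bij by (intro B.inv_equality) (auto simp: BijGroup_def)
      then show ?thesis using h by simp
    qed
  qed
next
  fix x y assume "x \<in> points" "y \<in> points"
  then obtain n c m d where xy: "x = (n, c)" "y = (m, d)" "n \<in> {0..<int p}" "m \<in> {0..<int p}"
      "c \<in> {0..<int q}" "d \<in> {0..<int q}"
    by (auto simp: points_def)
  obtain w where w: "w \<in> C" "w m = (d - c) mod int q"
    using onto_C[of "(d - c) mod int q" m] q_gt_1 by auto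
  have "act 0 (m - n) w x = y"
    using xy w by (simp add: act_apply mod_simps)
  then show "\<exists>g\<in>code_group. g x = y"
    using w by (auto simp: code_group_def)
qed

lemma act_normal_form:
  assumes "g \<in> code_group"
  shows "\<exists>i s w. i < k \<and> s \<in> {0..<int p} \<and> w \<in> C \<and> g = act i s w"
proof -
  obtain i s w where g: "g = act i s w" and w: "w \<in> C"
    using assms by (auto simp: code_group_def)
  have "[int q ^ i = int q ^ (i mod k)] (mod int p)"
  proof -
    have "[int q ^ ((i div k) * k) * int q ^ (i mod k) = 1 * int q ^ (i mod k)] (mod int p)"
      by (intro cong_mult q_power_k) auto
    moreover have "int q ^ i = int q ^ ((i div k) * k) * int q ^ (i mod k)"
      by (simp flip: power_add)
    ultimately show ?thesis by simp
  qed
  then have *: "[int q ^ i * n + s = int q ^ (i mod k) * n + s mod int p] (mod int p)" for n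
    by (intro cong_add cong_mult) auto
  have "act i s w = act (i mod k) (s mod int p) w"
  proof (rule act_eqI)
    fix n c assume nc: "n \<in> {0..<int p}" "c \<in> {0..<int q}"
    show "act i s w (n, c) = act (i mod k) (s mod int p) w (n, c)"
      using *[of n] cong_C[OF w *[of n]] nc by (simp add: act_apply cong_def)
  qed (simp_all add: act_extensional)
  then show ?thesis
    using g w k_pos p_gt_1
    by (intro exI[of _ "i mod k"] exI[of _ "s mod int p"] exI[of _ w]) auto
qed

lemma act_inject:
  assumes "i < k" "j < k" "s \<in> {0..<int p}" "t \<in> {0..<int p}" "w \<in> C" "v \<in> C"
    and eq: "act i s w = act j t v"
  shows "i = j \<and> s = t \<and> w = v"
proof -
  have at: "[int q ^ i * n + s = int q ^ j * n + t] (mod int p)"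
    "w (int q ^ i * n + s) = v (int q ^ j * n + t)" if "n \<in> {0..<int p}" for n
    using fun_cong[OF eq, of "(n, 0)"] that q_gt_1 range_C[OF \<open>w \<in> C\<close>] range_C[OF \<open>v \<in> C\<close>]
    by (simp_all add: act_apply cong_def)
  \<comment> \<open>The positions \<open>0\<close> and \<open>1\<close> determine the affine map.\<close>
  have st: "s = t"
    using at(1)[of 0] p_gt_1 assms(3,4) by (simp add: cong_def)
  have "[int q ^ i = int q ^ j] (mod int p)"
    using at(1)[of 1] p_gt_1 by (simp add: st cong_add_rcancel)
  then have "int p dvd int q ^ i - int q ^ j"
    by (simp add: cong_iff_dvd_diff)
  then have ij: "i = j"
    using coprime_q_power_diff[OF assms(1,2)] p_gt_1
    by (metis coprime_absorb_left not_prime_unit prime_nat_int_transfer prime_p)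
  have "w = v"
  proof
    fix m
    define n where "n = (int q ^ (i * (k - 1)) * (m - s)) mod int p"
    have "[int q ^ i * n = int q ^ i * (int q ^ (i * (k - 1)) * (m - s))] (mod int p)"
      unfolding n_def by (intro cong_scalar_left) simp
    also have "int q ^ i * (int q ^ (i * (k - 1)) * (m - s)) = (int q ^ i * int q ^ (i * (k - 1))) * (m - s)"
      by simp
    also have "[(int q ^ i * int q ^ (i * (k - 1))) * (m - s) = 1 * (m - s)] (mod int p)"
      by (intro cong_scalar_right q_power_inverse)
    finally have "[int q ^ i * n + s = 1 * (m - s) + s] (mod int p)"
      by (intro cong_add) auto
    then have "[int q ^ i * n + s = m] (mod int p)"
      by simp
    moreover have "n \<in> {0..<int p}" using p_gt_1 by (simp add: n_def)
    ultimately show "w m = v m"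
      using at(2)[of n] cong_C[OF assms(5)] cong_C[OF assms(6)] ij st by metis
  qed
  with ij st show ?thesis by simp
qed

lemma fibre_card_eq:
  assumes c: "c \<in> {0..<int q}"
  shows "card {w \<in> C. w d = c} * q = card C"
proof -
  have eq: "card {w \<in> C. w d = c} = card {w \<in> C. w d = 0}" if c: "c \<in> {0..<int q}" for c
  proof -
    obtain v where v: "v \<in> C" "v d = c" using onto_C[OF c] by blast
    have "bij_betw (\<lambda>w n. (w n + v n) mod int q) {w \<in> C. w d = 0} {w \<in> C. w d = c}"
    proof (rule bij_betw_byWitness[where f' = "\<lambda>w n. (w n - v n) mod int q"])
      show "\<forall>w\<in>{w \<in> C. w d = 0}. (\<lambda>n. ((w n + v n) mod int q - v n) mod int q) = w"
        using range_C by (auto simp: mod_simps fun_eq_iff)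
      show "\<forall>w\<in>{w \<in> C. w d = c}. (\<lambda>n. ((w n - v n) mod int q + v n) mod int q) = w"
        using range_C by (auto simp: mod_simps fun_eq_iff)
    qed (use v c add_C diff_C in auto)
    then show ?thesis by (simp add: bij_betw_same_card)
  qed
  have "C = (\<Union>c\<in>{0..<int q}. {w \<in> C. w d = c})"
    using range_C by auto
  then have "card C = card (\<Union>c\<in>{0..<int q}. {w \<in> C. w d = c})"
    by simp
  also have "\<dots> = (\<Sum>c\<in>{0..<int q}. card {w \<in> C. w d = c})"
    by (rule card_UN_disjoint) (auto simp: finite_C)
  also have "\<dots> = (\<Sum>c\<in>{0..<int q}. card {w \<in> C. w d = 0})"
    by (rule sum.cong[OF refl eq])
  finally show ?thesis
    using eq[OF c] by simp
qed

lemma card_stabilizer: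
  "card (stabilizer (perm_group points code_group) id (0, 0)) = k * card {w \<in> C. w 0 = 0}"
proof -
  define A where "A = {..<k} \<times> {w \<in> C. w 0 = 0}"
  have in_pts: "(0::int) \<in> {0..<int p}" "(0::int) \<in> {0..<int q}"
    using p_gt_1 q_gt_1 by auto
  have "{g \<in> code_group. g (0, 0) = (0, 0)} = (\<lambda>(i, w). act i 0 w) ` A"
  proof (intro equalityI subsetI)
    fix g assume g: "g \<in> {g \<in> code_group. g (0, 0) = (0, 0)}"
    then obtain i s w where *: "i < k" "s \<in> {0..<int p}" "w \<in> C" "g = act i s w"
      using act_normal_form by blast
    have "s = 0" "w 0 = 0"
      using g in_pts * range_C[OF \<open>w \<in> C\<close>, of 0] range_C[OF \<open>w \<in> C\<close>, of s]
      by (auto simp: act_apply)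
    then show "g \<in> (\<lambda>(i, w). act i 0 w) ` A"
      using * by (auto simp: A_def)
  next
    fix g assume "g \<in> (\<lambda>(i, w). act i 0 w) ` A"
    then show "g \<in> {g \<in> code_group. g (0, 0) = (0, 0)}"
      using in_pts by (auto simp: A_def code_group_def act_apply)
  qed
  moreover have "inj_on (\<lambda>(i, w). act i 0 w) A"
  proof (rule inj_onI, clarify)
    fix i w j v assume *: "(i, w) \<in> A" "(j, v) \<in> A" "act i 0 w = act j 0 v"
    show "i = j \<and> w = v"
      using act_inject[of i j 0 0 w v] * in_pts by (simp add: A_def)
  qed
  ultimately have "card {g \<in> code_group. g (0, 0) = (0, 0)} = card A"
    by (simp add: card_image)
  then show ?thesis
    by (simp add: stabilizer_perm_group A_def card_cartesian_product)
qed

text \<open>Two of these maps agree at a point as soon as the difference of their words has a zero.\<close>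

lemma intersecting_translations:
  assumes "\<And>w. w \<in> C \<Longrightarrow> \<exists>n. w n = 0"
  shows "intersecting points (act 0 0 ` C)"
  unfolding intersecting_def
proof (intro ballI)
  fix g h assume "g \<in> act 0 0 ` C" "h \<in> act 0 0 ` C"
  then obtain w v where wv: "w \<in> C" "v \<in> C" "g = act 0 0 w" "h = act 0 0 v" by blast
  obtain n where n: "(w n - v n) mod int q = 0"
    using assms[OF diff_C[OF wv(1,2)]] by (elim exE) (rule that)
  have wn: "w (n mod int p) = w n" "v (n mod int p) = v n"
    using cong_C[OF wv(1), of "n mod int p" n] cong_C[OF wv(2), of "n mod int p" n] by auto
  have "w n mod int q = v n mod int q"
    using n by (metis mod_eq_dvd_iff mod_0_imp_dvd)
  then have "g (n mod int p, 0) = h (n mod int p, 0)"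
    using p_gt_1 q_gt_1 by (simp add: wv act_apply wn)
  moreover have "(n mod int p, 0) \<in> points"
    using p_gt_1 q_gt_1 by (simp add: points_def)
  ultimately show "\<exists>\<omega>\<in>points. g \<omega> = h \<omega>" by blast
qed

lemma card_intersecting_le:
  assumes "k \<le> q" and F: "F \<subseteq> code_group" "intersecting points F"
  shows "card F \<le> card C"
proof -
  \<comment> \<open>The elements of \<open>F\<close> in terms of their parameters.\<close>
  define T where "T = {(i, s, w). i < k \<and> s \<in> {0..<int p} \<and> w \<in> C \<and> act i s w \<in> F}"
  have T_finite: "finite T"
    by (rule finite_subset[of _ "{..<k} \<times> {0..<int p} \<times> C"]) (auto simp: T_def finite_C)
  have "F \<subseteq> (\<lambda>(i, s, w). act i s w) ` T"
  proof
    fix g assume "g \<in> F"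
    then obtain i s w where "i < k" "s \<in> {0..<int p}" "w \<in> C" "g = act i s w"
      using F act_normal_form by blast
    with \<open>g \<in> F\<close> show "g \<in> (\<lambda>(i, s, w). act i s w) ` T"
      by (intro image_eqI[of _ _ "(i, s, w)"]) (auto simp: T_def)
  qed
  then have "card F \<le> card T"
    using T_finite by (meson card_image_le card_mono finite_imageI le_trans)
  also have "card T \<le> card C"
  proof -
    have agree: "\<exists>n. [int q ^ i * n + s = int q ^ j * n + t] (mod int p) \<and>
        w (int q ^ i * n + s) = v (int q ^ i * n + s)"
      if *: "(i, s, w) \<in> T" "(j, t, v) \<in> T" for i s w j t v
    proof -
      have wv: "w \<in> C" "v \<in> C" using that by (auto simp: T_def)
      obtain x where x: "x \<in> points" "act i s w x = act j t v x"
      proof -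
        have "act i s w \<in> F" "act j t v \<in> F" using * by (auto simp: T_def)
        then show thesis using F(2) that unfolding intersecting_def by blast
      qed
      obtain n c where "x = (n, c)" by (cases x)
      then have nc: "n \<in> {0..<int p}" "c \<in> {0..<int q}" "act i s w (n, c) = act j t v (n, c)"
        using x by (auto simp: points_def)
      then have 1: "[int q ^ i * n + s = int q ^ j * n + t] (mod int p)"
        and "[c + w (int q ^ i * n + s) = c + v (int q ^ j * n + t)] (mod int q)"
        by (simp_all add: act_apply cong_def)
      then have "[w (int q ^ i * n + s) = v (int q ^ j * n + t)] (mod int q)"
        by (simp add: cong_add_lcancel)
      then have "w (int q ^ i * n + s) = v (int q ^ j * n + t)"
        using range_C[OF wv(1), of "int q ^ i * n + s"] range_C[OF wv(2), of "int q ^ j * n + t"]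
        by (simp add: cong_def)
      then show ?thesis
        using 1 cong_C[OF wv(2) 1] by auto
    qed
    have same: "s = t" if "(i, s, w) \<in> T" "(i, t, v) \<in> T" for i s w t v
    proof -
      have "[s = t] (mod int p)"
        using agree[OF that] by (auto simp: cong_add_lcancel)
      then show ?thesis using that by (auto simp: T_def cong_def)
    qed
    show ?thesis
    proof (cases "\<exists>i. fst ` T \<subseteq> {i}")
      case True
      then obtain i where i: "\<And>x. x \<in> T \<Longrightarrow> fst x = i" by blast
      show ?thesis
      proof (rule card_inj_on_le[of "snd \<circ> snd"])
        show "inj_on (snd \<circ> snd) T"
        proof (rule inj_onI)
          fix x y assume *: "x \<in> T" "y \<in> T" "(snd \<circ> snd) x = (snd \<circ> snd) y"
          obtain s w where x: "x = (i, s, w)" using i[OF *(1)] by (cases x) auto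
          obtain t v where y: "y = (i, t, v)" using i[OF *(2)] by (cases y) auto
          show "x = y" using same[of i s w t v] * x y by simp
        qed
      qed (auto simp: T_def finite_C)
    next
      case False
      define m where "m = card {w \<in> C. w 0 = 0}"
      have fibre: "card {w \<in> C. w d = c} = m" if "c \<in> {0..<int q}" for c d
      proof -
        have "card {w \<in> C. w d = c} * q = m * q"
          using fibre_card_eq[OF that, of d] fibre_card_eq[of 0 0] q_gt_1 by (simp add: m_def)
        then show ?thesis using q_gt_1 by simp
      qed
      have le: "card {x \<in> T. fst x = i} \<le> m" for i
      proof (cases "{x \<in> T. fst x = i} = {}")
        case True
        then show ?thesis by (metis card.empty le0)
      next
        case False': False
        then obtain s w where x: "(i, s, w) \<in> T" by auto
        \<comment> \<open>An element with another exponent pins the words of all elements with exponent \<open>i\<close> at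
          one position \<open>d\<close>.\<close>
        obtain j t v where y: "(j, t, v) \<in> T" "j \<noteq> i"
          using False by force
        have v: "v \<in> C" using y by (auto simp: T_def)
        obtain n where n: "[int q ^ i * n + s = int q ^ j * n + t] (mod int p)"
          using agree[OF x y(1)] by blast
        define d where "d = int q ^ i * n + s"
        have "{x \<in> T. fst x = i} \<subseteq> (\<lambda>w. (i, s, w)) ` {w \<in> C. w d = v d}"
        proof
          fix z assume "z \<in> {x \<in> T. fst x = i}"
          then obtain s' w' where z: "z = (i, s', w')" "(i, s', w') \<in> T" by (cases z) auto
          then have w': "w' \<in> C" by (auto simp: T_def)
          have s': "s' = s" by (rule same[OF z(2) x])
          obtain n' where n': "[int q ^ i * n' + s = int q ^ j * n' + t] (mod int p)"
            "w' (int q ^ i * n' + s) = v (int q ^ i * n' + s)"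
            using agree[OF z(2) y(1)] s' by blast
          have "int p dvd (int q ^ i * n + s - (int q ^ j * n + t)) -
              (int q ^ i * n' + s - (int q ^ j * n' + t))"
            using dvd_diff[OF n[unfolded cong_iff_dvd_diff] n'(1)[unfolded cong_iff_dvd_diff]] .
          also have "\<dots> = (int q ^ i - int q ^ j) * (n - n')"
            by (simp add: algebra_simps)
          finally have "int p dvd n - n'"
            using coprime_q_power_diff[of i j] x y by (simp add: coprime_dvd_mult_right_iff T_def)
          then have "[int q ^ i * n + s = int q ^ i * n' + s] (mod int p)"
            by (intro cong_add cong_scalar_left) (auto simp: cong_iff_dvd_diff)
          then have "w' d = v d"
            using n'(2) cong_C[OF w', of d "int q ^ i * n' + s"] cong_C[OF v, of d "int q ^ i * n' + s"]
            by (simp add: d_def)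
          then show "z \<in> (\<lambda>w. (i, s, w)) ` {w \<in> C. w d = v d}"
            using z s' w' by auto
        qed
        then have "card {x \<in> T. fst x = i} \<le> card {w \<in> C. w d = v d}"
          using surj_card_le[of "{w \<in> C. w d = v d}"] finite_C by simp
        then show ?thesis
          using fibre[OF range_C[OF v]] by simp
      qed
      have "T = (\<Union>i\<in>{..<k}. {x \<in> T. fst x = i})"
        by (auto simp: T_def)
      then have "card T = card (\<Union>i\<in>{..<k}. {x \<in> T. fst x = i})"
        by simp
      also have "\<dots> \<le> (\<Sum>i\<in>{..<k}. card {x \<in> T. fst x = i})"
        by (rule card_UN_le) simp
      also have "\<dots> \<le> (\<Sum>i\<in>{..<k}. m)"
        by (intro sum_mono le)
      also have "\<dots> \<le> m * q"
        using \<open>k \<le> q\<close> by simp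
      also have "\<dots> = card C"
        using fibre_card_eq[of 0 0] q_gt_1 by (simp add: m_def)
      finally show ?thesis .
    qed
  qed
  finally show ?thesis .
qed

lemma intersection_density_code_group:
  assumes "k \<le> q" and "\<And>w. w \<in> C \<Longrightarrow> \<exists>n. w n = 0"
  shows "intersection_density points code_group = real q / real k"
proof -
  define m where "m = card {w \<in> C. w 0 = 0}"
  have in_pts: "(0, 0) \<in> points"
    using p_gt_1 q_gt_1 by (simp add: points_def)
  have cardC: "card C = m * q"
    using fibre_card_eq[of 0 0] q_gt_1 by (simp add: m_def)
  have m: "m > 0"
    using zero_C finite_C by (auto simp: m_def card_gt_0_iff)
  have fin: "finite code_group"
  proof (rule finite_subset)
    show "code_group \<subseteq> points \<rightarrow>\<^sub>E points"
      using code_group_Bij by (auto simp: Bij_def bij_betw_def PiE_def)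
    show "finite (points \<rightarrow>\<^sub>E points)"
      using finite_points by (simp add: finite_PiE)
  qed
  let ?S = "{real (card F) / real (k * m) | F. F \<subseteq> code_group \<and> intersecting points F}"
  have "intersection_density points code_group = Max ?S"
    using intersection_density_eq[OF transitive_code_group finite_points in_pts]
    by (simp add: card_stabilizer m_def)
  also have "Max ?S = real (card C) / real (k * m)"
  proof (rule Max_eqI)
    have "?S \<subseteq> (\<lambda>F. real (card F) / real (k * m)) ` Pow code_group" by auto
    then show "finite ?S" using fin finite_subset by blast
    show "y \<le> real (card C) / real (k * m)" if "y \<in> ?S" for y
      using that card_intersecting_le[OF assms(1)] by (auto intro!: divide_right_mono)
    have "inj_on (act 0 0) C"
      by (rule inj_onI) (use act_inject[of 0 0 0 0] k_pos p_gt_1 in auto)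
    then have "card (act 0 0 ` C) = card C" by (rule card_image)
    moreover have "act 0 0 ` C \<subseteq> code_group" by (auto simp: code_group_def)
    ultimately show "real (card C) / real (k * m) \<in> ?S"
      using intersecting_translations[OF assms(2)]
      by (intro CollectI exI[of _ "act 0 0 ` C"]) auto
  qed
  also have "\<dots> = real q / real k"
    using m k_pos by (simp add: cardC)
  finally show ?thesis .
qed

end

section \<open>Coefficients modulo \<open>x\<^sup>p - 1\<close>\<close>

text \<open>The coefficient at \<open>x ^ n\<close> of the residue of \<open>P\<close> modulo \<open>x ^ p - 1\<close>: the sum of all
  coefficients whose index is congruent to \<open>n\<close>. Indices are integers, so that shifts need no
  side conditions.\<close>

definition cyclic_coeff :: "nat \<Rightarrow> int poly \<Rightarrow> int \<Rightarrow> int" where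
  "cyclic_coeff p P n = (\<Sum>i\<le>degree P. if int p dvd int i - n then coeff P i else 0)"

lemma cyclic_coeff_le:
  assumes "degree P \<le> N"
  shows "cyclic_coeff p P n = (\<Sum>i\<le>N. if int p dvd int i - n then coeff P i else 0)"
  unfolding cyclic_coeff_def
  by (rule sum.mono_neutral_left) (use assms in \<open>auto simp: coeff_eq_0\<close>)

lemma cyclic_coeff_0 [simp]: "cyclic_coeff p 0 n = 0"
  unfolding cyclic_coeff_def by (rule sum.neutral) simp

lemma cyclic_coeff_add: "cyclic_coeff p (P + Q) n = cyclic_coeff p P n + cyclic_coeff p Q n"
proof -
  define N where "N = max (degree P) (degree Q)"
  have "degree (P + Q) \<le> N" "degree P \<le> N" "degree Q \<le> N"
    by (auto simp: N_def degree_add_le_max)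
  then show ?thesis
    by (auto simp: cyclic_coeff_le[where N = N] simp flip: sum.distrib intro!: sum.cong)
qed

lemma cyclic_coeff_smult: "cyclic_coeff p (smult a P) n = a * cyclic_coeff p P n"
proof -
  have "degree (smult a P) \<le> degree P" "degree P \<le> degree P"
    by (auto simp: degree_smult_le)
  then show ?thesis
    by (auto simp: cyclic_coeff_le[where N = "degree P"] sum_distrib_left intro!: sum.cong)
qed

lemma cyclic_coeff_minus: "cyclic_coeff p (- P) n = - cyclic_coeff p P n"
  using cyclic_coeff_smult[of p "-1" P n] by simp

lemma cyclic_coeff_diff: "cyclic_coeff p (P - Q) n = cyclic_coeff p P n - cyclic_coeff p Q n"
  using cyclic_coeff_add[of p P "- Q" n] by (simp add: cyclic_coeff_minus)

lemma cyclic_coeff_pCons: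
  "cyclic_coeff p (pCons a P) n = (if int p dvd n then a else 0) + cyclic_coeff p P (n - 1)"
proof -
  have "cyclic_coeff p (pCons a P) n =
      (\<Sum>i\<le>Suc (degree P). if int p dvd int i - n then coeff (pCons a P) i else 0)"
    by (rule cyclic_coeff_le) (rule degree_pCons_le)
  also have "\<dots> = (if int p dvd n then a else 0) + cyclic_coeff p P (n - 1)"
    unfolding cyclic_coeff_def
    by (subst sum.atMost_Suc_shift) (auto simp: algebra_simps intro!: sum.cong)
  finally show ?thesis .
qed

lemma cyclic_coeff_monom_mult:
  "cyclic_coeff p (monom a s * P) n = a * cyclic_coeff p P (n - int s)"
proof (induction s arbitrary: n)
  case 0
  then show ?case by (simp add: monom_0 cyclic_coeff_smult)
next
  case (Suc s)
  have "monom a (Suc s) * P = pCons 0 (monom a s * P)"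
    by (simp add: monom_Suc)
  moreover have "n - 1 - int s = n - int (Suc s)"
    by simp
  ultimately show ?case
    by (simp only: cyclic_coeff_pCons Suc) simp
qed

lemma cyclic_coeff_cong:
  assumes "[n = m] (mod int p)"
  shows "cyclic_coeff p P n = cyclic_coeff p P m"
proof -
  have "int p dvd int i - n \<longleftrightarrow> int p dvd int i - m" for i
    using assms by (meson cong_iff_dvd_diff cong_sym cong_trans)
  then show ?thesis
    by (simp add: cyclic_coeff_def)
qed

lemma sum_cyclic_coeff:
  assumes "p > 0"
  shows "(\<Sum>n\<in>{0..<int p}. cyclic_coeff p P n) = poly P 1"
proof -
  have *: "(\<Sum>n\<in>{0..<int p}. if int p dvd int i - n then coeff P i else 0) = coeff P i" for i
  proof -
    have "{0..<int p} \<inter> {n. int p dvd int i - n} = {int i mod int p}"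
    proof -
      have "n = int i mod int p" if "0 \<le> n" "n < int p" "int p dvd int i - n" for n
        using that by (metis cong_iff_dvd_diff cong_def mod_pos_pos_trivial)
      moreover have "int p dvd int i - int i mod int p"
        by (simp add: minus_mod_eq_mult_div)
      ultimately show ?thesis
        using assms by auto
    qed
    then show ?thesis
      by (simp add: sum.If_cases)
  qed
  have "(\<Sum>n\<in>{0..<int p}. cyclic_coeff p P n) = (\<Sum>i\<le>degree P. coeff P i)"
    unfolding cyclic_coeff_def by (subst sum.swap) (simp add: *)
  then show ?thesis
    by (simp add: poly_altdef)
qed

lemma cyclic_coeff_pcompose:
  assumes "coprime (int r) (int p)"
  shows "cyclic_coeff p (pcompose P (monom 1 r)) (int r * n) = cyclic_coeff p P n"
proof (induction P arbitrary: n)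
  case 0
  then show ?case by simp
next
  case (pCons a P)
  have "int p dvd int r * n \<longleftrightarrow> int p dvd n"
    using assms by (simp add: coprime_dvd_mult_right_iff coprime_commute)
  moreover have "int r * n - int r = int r * (n - 1)"
    by (simp add: algebra_simps)
  ultimately show ?case
    by (simp add: pcompose_pCons cyclic_coeff_add cyclic_coeff_monom_mult cyclic_coeff_pCons
        pCons.IH)
qed


section \<open>Frobenius on integer polynomials and roots modulo a prime ideal\<close>

lemma prime_dvd_power_add_diff:
  fixes a b :: "'a :: comm_ring_1"
  assumes "prime q"
  shows "of_nat q dvd (a + b) ^ q - (a ^ q + b ^ q)"
proof -
  have q: "q > 0" using assms prime_gt_0_nat by blast
  have "(a + b) ^ q = (\<Sum>i\<le>q. of_nat (q choose i) * a ^ i * b ^ (q - i))"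
    by (rule binomial_ring)
  also have "{..q} = insert 0 (insert q {0<..<q})"
    using q by auto
  also have "(\<Sum>i\<in>\<dots>. of_nat (q choose i) * a ^ i * b ^ (q - i)) =
      b ^ q + (a ^ q + (\<Sum>i\<in>{0<..<q}. of_nat (q choose i) * a ^ i * b ^ (q - i)))"
    using q by simp
  finally have "(a + b) ^ q - (a ^ q + b ^ q) =
      (\<Sum>i\<in>{0<..<q}. of_nat (q choose i) * a ^ i * b ^ (q - i))"
    by simp
  moreover have "of_nat q dvd (of_nat (q choose i) :: 'a)" if "i \<in> {0<..<q}" for i
  proof -
    have "q dvd q choose i"
      using that assms by (intro dvd_choose_prime) auto
    then show ?thesis by (metis dvd_def of_nat_mult)
  qed
  ultimately show ?thesis
    by (auto intro!: dvd_sum dvd_mult2)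
qed

lemma prime_dvd_power_diff_self:
  assumes "prime q"
  shows "int q dvd a ^ q - a"
proof (induction a rule: int_induct[where k = 0])
  case base
  then show ?case using assms prime_gt_0_nat[of q] by (simp add: zero_power)
next
  case (step1 i)
  have "(i + 1) ^ q - (i + 1) = ((i + 1) ^ q - (i ^ q + 1 ^ q)) + (i ^ q - i)"
    by simp
  moreover have "int q dvd (i + 1) ^ q - (i ^ q + 1 ^ q)"
    using prime_dvd_power_add_diff[OF assms, of i 1] by simp
  ultimately show ?case
    using step1.IH by (metis dvd_add)
next
  case (step2 i)
  have "(i - 1) ^ q - (i - 1) = (i ^ q - i) - (i ^ q - ((i - 1) ^ q + 1 ^ q))"
    by simp
  moreover have "int q dvd i ^ q - ((i - 1) ^ q + 1 ^ q)"
    using prime_dvd_power_add_diff[OF assms, of "i - 1" 1] by simp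
  ultimately show ?case
    using step2.IH by (metis dvd_diff)
qed

text \<open>The congruence \<open>P(x) ^ q = P(x ^ q)\<close> modulo \<open>q\<close>.\<close>

lemma power_prime_cong_pcompose:
  fixes P :: "int poly"
  assumes "prime q"
  shows "of_nat q dvd P ^ q - pcompose P (monom 1 q)"
proof (induction P)
  case 0
  then show ?case using assms prime_gt_0_nat[of q] by (simp add: zero_power)
next
  case (pCons a P)
  let ?X = "monom 1 1 :: int poly"
  have eq: "pCons a P = [:a:] + ?X * P"
    by (simp add: monom_altdef)
  have 1: "of_nat q dvd ([:a:] + ?X * P) ^ q - ([:a:] ^ q + ?X ^ q * P ^ q)"
    unfolding power_mult_distrib[symmetric] by (rule prime_dvd_power_add_diff) fact
  have "int q dvd a ^ q - a"
    by (rule prime_dvd_power_diff_self) fact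
  then have 2: "of_nat q dvd [:a:] ^ q - [:a:]"
    by (simp add: of_nat_poly poly_const_pow const_poly_dvd_const_poly_iff)
  have 3: "of_nat q dvd ?X ^ q * P ^ q - monom 1 q * pcompose P (monom 1 q)"
  proof -
    have "?X ^ q * P ^ q - monom 1 q * pcompose P (monom 1 q) =
        monom 1 q * (P ^ q - pcompose P (monom 1 q))"
      by (simp add: monom_power algebra_simps)
    then show ?thesis using pCons.IH by simp
  qed
  have "(pCons a P) ^ q - pcompose (pCons a P) (monom 1 q) =
     (([:a:] + ?X * P) ^ q - ([:a:] ^ q + ?X ^ q * P ^ q)) + ([:a:] ^ q - [:a:]) +
     (?X ^ q * P ^ q - monom 1 q * pcompose P (monom 1 q))"
    by (simp only: eq[symmetric] pcompose_pCons)
  then show ?case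
    using 1 2 3 by (metis dvd_add)
qed

text \<open>A polynomial whose leading coefficient lies outside a prime ideal \<open>M\<close> has at most as many roots
  modulo \<open>M\<close> as its degree. This is the bound for integral domains, stated with representatives
  instead of a quotient ring.\<close>

lemma card_roots_mod_prime_ideal:
  fixes f :: "'a :: comm_ring_1 poly" and M T :: "'a set"
  assumes M: "\<And>a b. a \<in> M \<Longrightarrow> b \<in> M \<Longrightarrow> a + b \<in> M" "\<And>a b. b \<in> M \<Longrightarrow> a * b \<in> M"
    and prime: "\<And>a b. a * b \<in> M \<Longrightarrow> a \<in> M \<or> b \<in> M"
    and "lead_coeff f \<notin> M" and "finite T"
    and "\<And>a. a \<in> T \<Longrightarrow> poly f a \<in> M"
    and "\<And>a b. a \<in> T \<Longrightarrow> b \<in> T \<Longrightarrow> a \<noteq> b \<Longrightarrow> a - b \<notin> M"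
  shows "card T \<le> degree f"
  using assms(4-)
proof (induction "degree f" arbitrary: f T)
  case 0
  then obtain c where "f = [:c:]" by (metis degree_eq_zeroE)
  with 0 have "T = {}" by auto
  then show ?case by simp
next
  case (Suc d)
  show ?case
  proof (cases "T = {}")
    case False
    then obtain a where a: "a \<in> T" by blast
    define g where "g = synthetic_div f a"
    have f: "f = [:-a, 1:] * g + [:poly f a:]"
      unfolding g_def by (rule synthetic_div_correct'[symmetric])
    have deg: "degree g = d"
      using Suc.hyps(2) by (simp add: g_def degree_synthetic_div)
    have "lead_coeff f = coeff g d"
    proof -
      have "coeff f (Suc d) = coeff g d"
        by (subst f) (use deg in \<open>simp add: coeff_eq_0\<close>)
      then show ?thesis using Suc.hyps(2) by simp
    qed
    then have "lead_coeff g \<notin> M"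
      using Suc.prems(1) deg by simp
    moreover have "poly g b \<in> M" if b: "b \<in> T - {a}" for b
    proof -
      have "poly f b = (b - a) * poly g b + poly f a"
        using arg_cong[OF f, of "\<lambda>r. poly r b"] by (simp add: algebra_simps)
      then have "(b - a) * poly g b = poly f b + (-1) * poly f a"
        by (simp add: algebra_simps)
      also have "\<dots> \<in> M"
        using M a b Suc.prems(3) by (meson DiffD1)
      finally show ?thesis
        using prime a b Suc.prems(4)[of b a] by blast
    qed
    ultimately have "card (T - {a}) \<le> degree g"
      using Suc.hyps(1)[of g "T - {a}"] Suc.prems deg by auto
    then show ?thesis
      using a Suc.prems(2) deg Suc.hyps(2) by (simp add: card_Diff_singleton)
  qed simp
qed

section \<open>An irreducible cyclic code of dimension \<open>k\<close>\<close>

text \<open>Under these parameters the code constructed below has \<open>q ^ k\<close> words and all its nonzero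
  words are equal up to shifts and scalars, as in the simplex code.\<close>

locale simplex_parameters =
  fixes p q k :: nat
  assumes prime_p: "prime p" and prime_q: "prime q"
    and k_gt_1: "k > 1"
    and size_eq: "q ^ k = p * (q - 1) + 1"
begin

text \<open>The kernel of the reduction modulo \<open>q\<close> and \<open>x ^ p - 1\<close>. Integer polynomials are used as
  representatives of the elements of the quotient ring.\<close>

definition vanishing :: "int poly set" where
  "vanishing = {P. \<forall>n. int q dvd cyclic_coeff p P n}"

text \<open>The word of a polynomial lists the coefficients of its residue modulo \<open>q\<close> and \<open>x ^ p - 1\<close>.\<close>

definition word :: "int poly \<Rightarrow> int \<Rightarrow> int" where
  "word P n = cyclic_coeff p P n mod int q"

text \<open>The principal ideal generated by \<open>u\<close> in the quotient ring, as a set of words.\<close>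

definition generated_code :: "int poly \<Rightarrow> (int \<Rightarrow> int) set" where
  "generated_code u = range (\<lambda>P. word (P * u))"

lemma p_gt_1: "p > 1" and q_gt_1: "q > 1"
  using prime_p prime_q prime_gt_1_nat by auto

lemma q_less_p: "q < p"
proof -
  have "q ^ 2 \<le> q ^ k"
    using k_gt_1 q_gt_1 by (intro power_increasing) auto
  then have "(q - 1) * (q + 1) < (q - 1) * p + 1"
    using size_eq q_gt_1 by (simp add: algebra_simps power2_eq_square)
  then have "(q - 1) * (q + 1) \<le> (q - 1) * p"
    by linarith
  then have "q + 1 \<le> p"
    using q_gt_1 by (simp only: mult_le_cancel1)
  then show ?thesis
    by simp
qed

lemma coprime_q_p: "coprime (int q) (int p)"
  using prime_p prime_q q_less_p by (simp add: primes_coprime)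

lemma prime_int_q: "prime (int q)" and prime_int_p: "prime (int p)"
  using prime_q prime_p by auto

lemma vanishing_add: "P \<in> vanishing \<Longrightarrow> Q \<in> vanishing \<Longrightarrow> P + Q \<in> vanishing"
  by (auto simp: vanishing_def cyclic_coeff_add)

lemma vanishing_mult:
  assumes "P \<in> vanishing"
  shows "R * P \<in> vanishing"
proof (induction R)
  case 0
  then show ?case by (simp add: vanishing_def)
next
  case (pCons a R)
  have "pCons a R * P = smult a P + monom 1 1 * (R * P)"
    by (simp add: monom_altdef)
  then show ?case
    using assms pCons.IH
    by (auto simp: vanishing_def cyclic_coeff_add cyclic_coeff_smult cyclic_coeff_monom_mult)
qed

lemma vanishing_of_nat_dvd:
  assumes "of_nat q dvd P"
  shows "P \<in> vanishing"
proof -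
  obtain Q where "P = smult (int q) Q"
    using assms by (auto simp: of_nat_poly)
  then show ?thesis
    by (simp add: vanishing_def cyclic_coeff_smult)
qed

lemma word_eq_iff: "word P = word Q \<longleftrightarrow> P - Q \<in> vanishing"
  by (auto simp: word_def vanishing_def fun_eq_iff cyclic_coeff_diff mod_eq_dvd_iff)

lemma word_range: "word P n \<in> {0..<int q}"
  using q_gt_1 by (simp add: word_def)

lemma word_cong: "[n = m] (mod int p) \<Longrightarrow> word P n = word P m"
  by (simp add: word_def cyclic_coeff_cong)

lemma finite_generated_code: "finite (generated_code u)"
proof -
  have "inj_on (\<lambda>w. restrict w {0..<int p}) (range word)"
  proof (rule inj_onI)
    fix w v assume *: "w \<in> range word" "v \<in> range word"
      "restrict w {0..<int p} = restrict v {0..<int p}"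
    then obtain P Q where PQ: "w = word P" "v = word Q" by blast
    show "w = v"
    proof
      fix n
      have "n mod int p \<in> {0..<int p}"
        using p_gt_1 by simp
      then have "w (n mod int p) = v (n mod int p)"
        using *(3) by (metis restrict_apply')
      then show "w n = v n"
        using word_cong[of n "n mod int p"] by (simp add: PQ)
    qed
  qed
  moreover have "(\<lambda>w. restrict w {0..<int p}) ` range word \<subseteq> {0..<int p} \<rightarrow>\<^sub>E {0..<int q}"
    using word_range by auto
  ultimately have "finite (range word)"
    by (meson finite_PiE finite_atLeastLessThan_int finite_imageD finite_subset)
  then show ?thesis
    by (rule finite_subset[rotated]) (auto simp: generated_code_def)
qed

text \<open>The generators of minimal nonzero ideals inside the ideal of polynomials with coefficient sum
  zero. The condition on \<open>poly u 1\<close> excludes the code of constant words.\<close>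

definition irreducible_generator :: "int poly \<Rightarrow> bool" where
  "irreducible_generator u \<longleftrightarrow> u \<notin> vanishing \<and> int q dvd poly u 1 \<and>
     (\<forall>P. P * u \<notin> vanishing \<longrightarrow> generated_code (P * u) = generated_code u)"

lemma ex_irreducible_generator: "\<exists>u. irreducible_generator u"
proof -
  let ?ok = "\<lambda>u. u \<notin> vanishing \<and> int q dvd poly u 1"
  \<comment> \<open>The polynomial \<open>x - 1\<close> generates a nonzero code with coefficient sum zero; a code of least
    size among these is minimal.\<close>
  have "[:-1, 1:] \<notin> vanishing"
  proof -
    have "cyclic_coeff p [:-1, 1:] 0 = -1"
      using p_gt_1 by (simp add: cyclic_coeff_pCons)
    then show ?thesis
      using q_gt_1 by (auto simp: vanishing_def intro!: exI[of _ 0])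
  qed
  then have "?ok [:-1, 1:]" by simp
  then obtain u where u: "?ok u" "\<And>v. ?ok v \<Longrightarrow> card (generated_code u) \<le> card (generated_code v)"
    using ex_has_least_nat[of ?ok _ "\<lambda>u. card (generated_code u)"] by blast
  have "generated_code (P * u) = generated_code u" if P: "P * u \<notin> vanishing" for P
  proof (rule card_seteq)
    show "finite (generated_code u)" by (rule finite_generated_code)
    show "generated_code (P * u) \<subseteq> generated_code u"
      by (auto simp: generated_code_def simp flip: mult.assoc)
    show "card (generated_code u) \<le> card (generated_code (P * u))"
      using u P by simp
  qed
  then show ?thesis
    using u(1) by (auto simp: irreducible_generator_def)
qed

lemma cyclic_coeff_frobenius:
  "[cyclic_coeff p (P ^ q) (int q * n) = cyclic_coeff p P n] (mod int q)"
proof -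
  have "P ^ q - pcompose P (monom 1 q) \<in> vanishing"
    by (intro vanishing_of_nat_dvd power_prime_cong_pcompose prime_q)
  then have "[cyclic_coeff p (P ^ q) (int q * n) =
      cyclic_coeff p (pcompose P (monom 1 q)) (int q * n)] (mod int q)"
    by (auto simp: vanishing_def cong_iff_dvd_diff cyclic_coeff_diff)
  then show ?thesis
    by (simp only: cyclic_coeff_pcompose[OF coprime_q_p])
qed

lemma cyclic_coeff_frobenius_power:
  "[cyclic_coeff p (P ^ (q ^ i)) (int (q ^ i) * n) = cyclic_coeff p P n] (mod int q)"
proof (induction i arbitrary: n)
  case (Suc i)
  have "[cyclic_coeff p ((P ^ (q ^ i)) ^ q) (int q * (int (q ^ i) * n)) =
     cyclic_coeff p (P ^ (q ^ i)) (int (q ^ i) * n)] (mod int q)"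
    by (rule cyclic_coeff_frobenius)
  also have "[cyclic_coeff p (P ^ (q ^ i)) (int (q ^ i) * n) = cyclic_coeff p P n] (mod int q)"
    by (rule Suc)
  finally have "[cyclic_coeff p ((P ^ (q ^ i)) ^ q) (int q * (int (q ^ i) * n)) =
     cyclic_coeff p P n] (mod int q)" .
  moreover have "(P ^ (q ^ i)) ^ q = P ^ (q ^ Suc i)"
    by (simp add: mult.commute flip: power_mult)
  moreover have "int q * (int (q ^ i) * n) = int (q ^ Suc i) * n"
    by simp
  ultimately show ?case
    by (simp only:)
qed simp

lemma frobenius_fixed: "P ^ (q ^ k) - P \<in> vanishing"
proof -
  have "[cyclic_coeff p (P ^ (q ^ k)) n = cyclic_coeff p P n] (mod int q)" for n
  proof -
    have "[int (q ^ k) * n = n] (mod int p)"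
      unfolding size_eq by (simp add: cong_iff_dvd_diff algebra_simps)
    from cyclic_coeff_cong[OF this] show ?thesis
      using cyclic_coeff_frobenius_power[of P k n] by simp
  qed
  then show ?thesis
    by (simp add: vanishing_def cong_iff_dvd_diff cyclic_coeff_diff)
qed

text \<open>By minimality the annihilator \<open>M\<close> of \<open>u\<close> is a prime ideal, and \<open>P \<mapsto> P u\<close> embeds the
  residues modulo \<open>M\<close> into the code. All of them are roots of \<open>X ^ (q ^ k) - X\<close>.\<close>

lemma card_generated_code_le:
  assumes u: "irreducible_generator u"
  shows "card (generated_code u) \<le> q ^ k"
proof -
  define M where "M = {P. P * u \<in> vanishing}"
  define rep where "rep w = (SOME P. w = word (P * u))" for w
  have rep: "w = word (rep w * u)" if "w \<in> generated_code u" for w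
    using that unfolding rep_def generated_code_def by (auto intro: someI)
  define T where "T = rep ` generated_code u"
  define f :: "int poly poly" where "f = monom 1 (q ^ k) + monom (-1) 1"
  have qk: "q ^ k > 1"
    using q_gt_1 k_gt_1 by (intro one_less_power) auto
  then have deg: "degree f = q ^ k"
    unfolding f_def by (subst degree_add_eq_left) (auto simp: degree_monom_eq)
  have lead: "lead_coeff f = 1"
    using qk by (simp add: deg) (simp add: f_def)
  have "card T \<le> degree f"
  proof (rule card_roots_mod_prime_ideal[where M = M])
    show "a + b \<in> M" if "a \<in> M" "b \<in> M" for a b
      using that by (simp add: M_def distrib_right vanishing_add)
    show "a * b \<in> M" if "b \<in> M" for a b
      using that by (simp add: M_def mult.assoc vanishing_mult)
    show "a \<in> M \<or> b \<in> M" if ab: "a * b \<in> M" for a b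
    proof (rule disjCI)
      assume "b \<notin> M"
      then have "generated_code (b * u) = generated_code u"
        using u by (auto simp: M_def irreducible_generator_def)
      moreover have "word u \<in> generated_code u"
        unfolding generated_code_def by (rule range_eqI[of _ _ 1]) simp
      ultimately obtain R where "word u = word (R * (b * u))"
        by (auto simp: generated_code_def)
      then have "a * (u - R * (b * u)) \<in> vanishing"
        by (simp add: word_eq_iff vanishing_mult)
      moreover have "R * (a * b * u) \<in> vanishing"
        using ab by (simp add: M_def vanishing_mult)
      ultimately have "a * (u - R * (b * u)) + R * (a * b * u) \<in> vanishing"
        by (rule vanishing_add)
      then show "a \<in> M"
        by (simp add: M_def algebra_simps)
    qed
    show "lead_coeff f \<notin> M"
      using u by (simp add: lead M_def irreducible_generator_def)
    show "finite T"
      by (simp add: T_def finite_generated_code)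
    show "poly f a \<in> M" for a
      using vanishing_mult[OF frobenius_fixed, of u a]
      by (simp add: f_def M_def poly_monom mult.commute)
    show "a - b \<notin> M" if "a \<in> T" "b \<in> T" "a \<noteq> b" for a b
    proof
      assume "a - b \<in> M"
      then have "word (a * u) = word (b * u)"
        by (simp add: M_def word_eq_iff left_diff_distrib)
      then show False
        using that rep by (auto simp: T_def)
    qed
  qed
  moreover have "card T = card (generated_code u)"
    unfolding T_def by (rule card_image) (use rep in \<open>metis inj_onI\<close>)
  ultimately show ?thesis
    by (simp add: deg)
qed

lemma coprime_p_q_minus_1: "coprime p (q - 1)"
  using prime_p q_less_p q_gt_1 by (intro prime_imp_coprime) (auto dest: dvd_imp_le)

text \<open>The group of units modulo \<open>q\<close> has order \<open>q - 1\<close>, which is prime to \<open>p\<close>.\<close>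

lemma cong_of_power_p_cong:
  assumes "[a ^ p = b ^ p] (mod int q)" "\<not> int q dvd a" "\<not> int q dvd b"
  shows "[a = b] (mod int q)"
proof -
  obtain x y where xy: "p * x = (q - 1) * y + 1"
    using bezout_nat[of p "q - 1"] coprime_p_q_minus_1 p_gt_1 by auto
  have *: "[c ^ (p * x) = c] (mod int q)" if "\<not> int q dvd c" for c
  proof -
    have "int q dvd c * (c ^ (q - 1) - 1)"
      using prime_dvd_power_diff_self[OF prime_q, of c] q_gt_1
      by (simp add: algebra_simps flip: power_Suc)
    then have "[c ^ (q - 1) = 1] (mod int q)"
      using that prime_int_q by (simp add: cong_iff_dvd_diff prime_dvd_mult_iff)
    then have "[(c ^ (q - 1)) ^ y * c = 1 ^ y * c] (mod int q)"
      by (intro cong_mult cong_pow) auto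
    moreover have "c ^ (p * x) = (c ^ (q - 1)) ^ y * c"
      by (simp only: xy power_add power_mult power_one_right)
    ultimately show ?thesis
      by simp
  qed
  have "[(a ^ p) ^ x = (b ^ p) ^ x] (mod int q)"
    by (intro cong_pow assms)
  then show ?thesis
    using *[OF assms(2)] *[OF assms(3)] by (metis cong_sym cong_trans power_mult)
qed

text \<open>If two scalar multiples of shifts of \<open>u\<close> coincide, then iterating the shift \<open>p\<close> times shows
  that the scalars are equal. A nontrivial shift that fixes \<open>u\<close> would make its word constant, hence
  zero, because its coefficient sum \<open>poly u 1\<close> is zero modulo \<open>q\<close> and \<open>p\<close> is prime to \<open>q\<close>.\<close>

lemma scalar_shift_eq:
  assumes u: "irreducible_generator u"
    and a: "a \<in> {1..<q}" and b: "b \<in> {1..<q}" and "s < p" "t < p"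
    and eq: "word (monom (int a) s * u) = word (monom (int b) t * u)"
  shows "a = b \<and> s = t"
proof -
  define c where "c = cyclic_coeff p u"
  define r where "r = int t - int s"
  have c_cong: "c n = c m" if "[n = m] (mod int p)" for n m
    using that by (simp add: c_def cyclic_coeff_cong)
  have nd: "\<not> int q dvd int a" "\<not> int q dvd int b"
    using a b by (auto dest: dvd_imp_le)
  obtain n0 where n0: "\<not> int q dvd c n0"
    using u by (auto simp: irreducible_generator_def vanishing_def c_def)
  have step: "[int a * c n = int b * c (n - r)] (mod int q)" for n
  proof -
    have "word (monom (int a) s * u) (n + int s) = word (monom (int b) t * u) (n + int s)"
      by (simp add: eq)
    moreover have "n + int s - int s = n" "n + int s - int t = n - r"
      by (simp_all add: r_def)
    ultimately show ?thesis
      by (simp add: word_def cyclic_coeff_monom_mult cong_def c_def)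
  qed
  have iter: "[int a ^ j * c n = int b ^ j * c (n - int j * r)] (mod int q)" for j n
  proof (induction j arbitrary: n)
    case (Suc j)
    have "[int a ^ j * (int a * c n) = int a ^ j * (int b * c (n - r))] (mod int q)"
      by (intro cong_mult step) auto
    also have "int a ^ j * (int b * c (n - r)) = int b * (int a ^ j * c (n - r))"
      by simp
    also have "[int b * (int a ^ j * c (n - r)) =
        int b * (int b ^ j * c (n - r - int j * r))] (mod int q)"
      by (intro cong_mult Suc) auto
    finally show ?case
      by (simp add: algebra_simps)
  qed simp
  have "c (n0 - int p * r) = c n0"
    by (rule c_cong) (simp add: cong_iff_dvd_diff)
  then have "[int a ^ p * c n0 = int b ^ p * c n0] (mod int q)"
    using iter[of p n0] by simp
  then have "[int a ^ p = int b ^ p] (mod int q)"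
    using n0 prime_int_q
    by (simp add: cong_iff_dvd_diff prime_dvd_mult_iff flip: left_diff_distrib)
  then have "[int a = int b] (mod int q)"
    by (rule cong_of_power_p_cong) (use nd in auto)
  then have ab: "a = b"
    using a b by (simp add: cong_less_modulus_unique_nat cong_int_iff)
  have const: "[c n = c (n - int j * r)] (mod int q)" for j n
  proof -
    have "int q dvd int a ^ j * (c n - c (n - int j * r))"
      using iter[of j n] by (simp add: ab cong_iff_dvd_diff right_diff_distrib)
    moreover have "\<not> int q dvd int a ^ j"
      using nd prime_int_q prime_dvd_power by blast
    ultimately show ?thesis
      using prime_int_q by (simp add: cong_iff_dvd_diff prime_dvd_mult_iff)
  qed
  have "s = t"
  proof (rule ccontr)
    assume "s \<noteq> t"
    then have "\<bar>r\<bar> < int p" "r \<noteq> 0"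
      using assms by (auto simp: r_def)
    then have "\<not> int p dvd r"
      using dvd_imp_le_int by force
    then have "coprime r (int p)"
      using prime_imp_coprime[OF prime_int_p] by (simp add: coprime_commute)
    then obtain r' where r': "[r * r' = 1] (mod int p)"
      using coprime_iff_invertible_int by blast
    have c0: "[c n = c 0] (mod int q)" for n
    proof -
      \<comment> \<open>\<open>j\<close> steps of length \<open>r\<close> lead from \<open>n\<close> to \<open>0\<close> modulo \<open>p\<close>.\<close>
      define j where "j = nat (n * r' mod int p)"
      have j: "int j = n * r' mod int p"
        using p_gt_1 by (simp add: j_def)
      have "[int j * r = n * r' * r] (mod int p)"
        unfolding j by (intro cong_scalar_right) simp
      also have "n * r' * r = n * (r * r')"
        by simp
      also have "[n * (r * r') = n * 1] (mod int p)"
        using r' by (rule cong_scalar_left)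
      finally have "int p dvd n - int j * r"
        by (simp add: cong_iff_dvd_diff dvd_diff_commute)
      then have "c (n - int j * r) = c 0"
        by (intro c_cong) (simp add: cong_0_iff)
      then show ?thesis
        using const[of n j] by simp
    qed
    have "int q dvd (\<Sum>n\<in>{0..<int p}. c n)"
      using u p_gt_1 unfolding c_def
      by (subst sum_cyclic_coeff) (auto simp: irreducible_generator_def)
    moreover have "[(\<Sum>n\<in>{0..<int p}. c n) = (\<Sum>n\<in>{0..<int p}. c 0)] (mod int q)"
      by (intro cong_sum c0)
    ultimately have "int q dvd int p * c 0"
      by (simp add: cong_dvd_iff)
    then have "int q dvd c 0"
      using coprime_q_p by (simp add: coprime_dvd_mult_right_iff)
    then show False
      using c0[of n0] n0 by (simp add: cong_dvd_iff)
  qed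
  with ab show ?thesis by simp
qed

text \<open>The scalar multiples of shifts of \<open>u\<close> already account for \<open>p (q - 1) = q ^ k - 1\<close> nonzero
  words.\<close>

lemma
  assumes u: "irreducible_generator u"
  shows card_generated_code: "card (generated_code u) = q ^ k"
    and nonzero_word_is_scalar_shift: "w \<in> generated_code u \<Longrightarrow> w \<noteq> word 0 \<Longrightarrow>
      \<exists>a\<in>{1..<q}. \<exists>s<p. w = word (monom (int a) s * u)"
proof -
  define f where "f = (\<lambda>(a, s). word (monom (int a) s * u))"
  define A where "A = {1..<q} \<times> {..<p}"
  have inj: "inj_on f A"
    by (rule inj_onI) (use scalar_shift_eq[OF u] in \<open>auto simp: f_def A_def\<close>)
  have sub: "f ` A \<subseteq> generated_code u - {word 0}"
  proof -
    have "word (monom (int a) s * u) \<noteq> word 0" if "a \<in> {1..<q}" for a s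
    proof
      assume "word (monom (int a) s * u) = word 0"
      then have *: "int q dvd int a * cyclic_coeff p u (n - int s)" for n
        by (simp add: word_eq_iff vanishing_def cyclic_coeff_monom_mult)
      have "\<not> int q dvd int a"
        using that by (auto dest: dvd_imp_le)
      then have "int q dvd cyclic_coeff p u n" for n
        using *[of "n + int s"] prime_int_q by (simp add: prime_dvd_mult_iff)
      then show False
        using u by (auto simp: irreducible_generator_def vanishing_def)
    qed
    then show ?thesis
      by (auto simp: f_def A_def generated_code_def)
  qed
  have cardA: "card A = q ^ k - 1"
    by (simp add: A_def size_eq)
  have z: "word 0 \<in> generated_code u"
    unfolding generated_code_def by (rule range_eqI[of _ _ 0]) simp
  have le: "card (generated_code u - {word 0}) \<le> q ^ k - 1"
    using card_generated_code_le[OF u] z finite_generated_code by simp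
  have eq: "f ` A = generated_code u - {word 0}"
    using sub le card_image[OF inj] cardA finite_generated_code
    by (intro card_seteq) auto
  show "card (generated_code u) = q ^ k"
  proof -
    have "card (generated_code u) = Suc (card (generated_code u - {word 0}))"
      by (rule card.remove[OF finite_generated_code z])
    also have "\<dots> = q ^ k"
      unfolding eq[symmetric] card_image[OF inj] cardA using size_eq by simp
    finally show ?thesis .
  qed
  show "\<exists>a\<in>{1..<q}. \<exists>s<p. w = word (monom (int a) s * u)"
    if "w \<in> generated_code u" "w \<noteq> word 0"
  proof -
    have "w \<in> f ` A" using that eq by blast
    then show ?thesis by (auto simp: f_def A_def)
  qed
qed

text \<open>Since \<open>q ^ k > q\<close>, two words have the same entry at \<open>0\<close>. Their difference is a scalar multiple of
  a shift of \<open>u\<close>, so \<open>u\<close> has a zero entry, and then so has every word.\<close>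

lemma generated_code_zero:
  assumes u: "irreducible_generator u" and w: "w \<in> generated_code u"
  shows "\<exists>n. w n = 0"
proof (cases "w = word 0")
  case True
  then show ?thesis by (simp add: word_def)
next
  case False
  obtain n1 where n1: "int q dvd cyclic_coeff p u n1"
  proof -
    have "\<not> inj_on (\<lambda>w. w 0) (generated_code u)"
    proof (rule pigeonhole)
      have "(\<lambda>w. w 0) ` generated_code u \<subseteq> {0..<int q}"
        using word_range by (auto simp: generated_code_def)
      then have "card ((\<lambda>w. w 0) ` generated_code u) \<le> q"
        using card_mono[OF finite_atLeastLessThan_int, of _ 0 "int q"] by simp
      also have "q < q ^ k"
        using q_gt_1 k_gt_1 power_strict_increasing[of 1 k q] by simp
      finally show "card ((\<lambda>w. w 0) ` generated_code u) < card (generated_code u)"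
        by (simp add: card_generated_code[OF u])
    qed
    then obtain P Q where PQ: "word (P * u) 0 = word (Q * u) 0" "word (P * u) \<noteq> word (Q * u)"
      unfolding inj_on_def generated_code_def by blast
    then have "word ((P - Q) * u) \<noteq> word 0"
      by (simp add: word_eq_iff left_diff_distrib)
    moreover have "word ((P - Q) * u) \<in> generated_code u"
      by (auto simp: generated_code_def)
    ultimately obtain a s where a: "a \<in> {1..<q}" and as: "word ((P - Q) * u) = word (monom (int a) s * u)"
      using nonzero_word_is_scalar_shift[OF u] by blast
    have "word ((P - Q) * u) 0 = 0"
      using PQ(1) by (simp add: word_def left_diff_distrib cyclic_coeff_diff mod_eq_dvd_iff)
    then have "int q dvd int a * cyclic_coeff p u (0 - int s)"
      unfolding as unfolding word_def cyclic_coeff_monom_mult by presburger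
    moreover have "\<not> int q dvd int a"
      using a by (auto dest: dvd_imp_le)
    ultimately show ?thesis
      using that prime_int_q by (auto simp: prime_dvd_mult_iff)
  qed
  obtain a s where "w = word (monom (int a) s * u)"
    using nonzero_word_is_scalar_shift[OF u w False] by blast
  then have "w (n1 + int s) = 0"
    using n1 by (simp add: word_def cyclic_coeff_monom_mult)
  then show ?thesis ..
qed

lemma invariant_code_generated_code:
  assumes u: "irreducible_generator u"
  shows "invariant_code p q k (generated_code u)"
proof
  show "prime p" "q > 1" "k > 0" "q ^ k = p * (q - 1) + 1" "finite (generated_code u)"
    using prime_p q_gt_1 k_gt_1 size_eq finite_generated_code by auto
  fix w n assume w: "w \<in> generated_code u"
  then obtain P where P: "w = word (P * u)" by (auto simp: generated_code_def)
  show "w n \<in> {0..<int q}"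
    unfolding P by (rule word_range)
  show "w n = w m" if "[n = m] (mod int p)" for m
    unfolding P using that by (rule word_cong)
  show "(\<lambda>n. (w n + v n) mod int q) \<in> generated_code u" if "v \<in> generated_code u" for v
  proof -
    obtain Q where Q: "v = word (Q * u)" using \<open>v \<in> _\<close> by (auto simp: generated_code_def)
    have "(\<lambda>n. (w n + v n) mod int q) = word ((P + Q) * u)"
      by (simp add: P Q word_def fun_eq_iff distrib_right cyclic_coeff_add mod_simps)
    then show ?thesis by (auto simp: generated_code_def)
  qed
  have "(\<lambda>n. (- w n) mod int q) = word ((- P) * u)"
    by (simp add: P word_def fun_eq_iff cyclic_coeff_minus mod_simps)
  then show "(\<lambda>n. (- w n) mod int q) \<in> generated_code u"
    unfolding generated_code_def by blast
  show "\<exists>v\<in>generated_code u. \<forall>n. v (n + s) = w n" for s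
  proof -
    define t where "t = nat (s mod int p)"
    have t: "int t = s mod int p" using p_gt_1 by (simp add: t_def)
    have "word ((monom 1 t * P) * u) (n + s) = w n" for n
    proof -
      have "[n + s - int t = n + s - s] (mod int p)"
        unfolding t by (intro cong_diff) auto
      then have "cyclic_coeff p (P * u) (n + s - int t) = cyclic_coeff p (P * u) n"
        by (intro cyclic_coeff_cong) simp
      then show ?thesis
        by (simp only: mult.assoc cyclic_coeff_monom_mult word_def P mult_1)
    qed
    then show ?thesis by (auto simp: generated_code_def)
  qed
  show "\<exists>v\<in>generated_code u. \<forall>n. v (int q * n) = w n"
  proof -
    have "word ((P * u) ^ q) (int q * n) = w n" for n
      using cyclic_coeff_frobenius[of "P * u" n] by (simp add: word_def P cong_def)
    moreover have "(P * u) ^ q = ((P * u) ^ (q - 1) * P) * u"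
      using q_gt_1 by (simp add: power_eq_if mult_ac)
    ultimately show ?thesis
      unfolding generated_code_def by (metis rangeI)
  qed
next
  fix c n assume c: "c \<in> {0..<int q}"
  obtain n0 where n0: "\<not> int q dvd cyclic_coeff p u n0"
    using u by (auto simp: irreducible_generator_def vanishing_def)
  then have "coprime (cyclic_coeff p u n0) (int q)"
    using prime_imp_coprime[OF prime_int_q] coprime_commute by blast
  then obtain b where b: "[cyclic_coeff p u n0 * b = 1] (mod int q)"
    using coprime_iff_invertible_int by blast
  define t where "t = nat ((n - n0) mod int p)"
  have t: "int t = (n - n0) mod int p" using p_gt_1 by (simp add: t_def)
  have "[n - int t = n - (n - n0)] (mod int p)"
    unfolding t by (intro cong_diff) auto
  then have "cyclic_coeff p u (n - int t) = cyclic_coeff p u n0"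
    by (intro cyclic_coeff_cong) simp
  then have "word (monom (c * b) t * u) n = (c * (cyclic_coeff p u n0 * b)) mod int q"
    by (simp add: word_def cyclic_coeff_monom_mult) (simp add: mult_ac)
  also have "\<dots> = (c * 1) mod int q"
    using cong_scalar_left[OF b, of c] by (simp add: cong_def)
  also have "\<dots> = c"
    using c by simp
  finally show "\<exists>w\<in>generated_code u. w n = c"
    unfolding generated_code_def by blast
qed

end

section \<open>The group with intersection density \<open>q / k\<close>\<close>

theorem theorem1p7:
  fixes k p q :: nat
  assumes "k > 0"
    and "prime q" and "odd q"
    and "prime p" and "odd p"
    and "real p = (real q ^ k - 1) / (real q - 1)"
    and "k < q"
  shows "real q / real k \<in> intersection_densities (p * q)"
proof -
  have q: "q > 1" using assms(2) by (rule prime_gt_1_nat)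
  have "real p * (real q - 1) = real q ^ k - 1"
    using assms(6) q by simp
  then have "real (q ^ k) = real (p * (q - 1) + 1)"
    using q by (simp add: of_nat_diff)
  then have size: "q ^ k = p * (q - 1) + 1"
    by (simp only: of_nat_eq_iff)
  \<comment> \<open>For \<open>k = 1\<close> the quotient \<open>p\<close> is \<open>1\<close>.\<close>
  have "k \<noteq> 1"
  proof
    assume "k = 1"
    then have "q = (q - 1) * p + 1" using size by (simp add: mult.commute)
    then have "q - 1 = (q - 1) * p" by linarith
    then have "p = 1" using mult_eq_self_implies_10[of "q - 1" p] q by simp
    then show False using assms(4) by simp
  qed
  then interpret simplex_parameters p q k
    using assms size by unfold_locales auto
  obtain u where u: "irreducible_generator u"
    using ex_irreducible_generator by blast
  interpret invariant_code p q k "generated_code u"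
    using u by (rule invariant_code_generated_code)
  have "intersection_density points code_group = real q / real k"
    using assms(7) generated_code_zero[OF u] by (intro intersection_density_code_group) auto
  then show ?thesis
    using intersection_density_in_intersection_densities[OF transitive_code_group finite_points]
    by (simp add: card_points)
qed

end
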